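(* Let $J(x,y,z)$ be the exponential generating function in which the coefficient of $x^ry^d\frac{z^n}{n!}$ is the number of increasing binary trees of size $n$ whose $r$th internal node has depth $d$ (for $0\le r\le n-1$). Then $$J(x,y,z)=\left((1-z)(1-xz)\right)^{-y}\int_0^z \left((1-t)(1-xt)\right)^{y-1}\,dt.$$
   Context: A binary tree here means a complete binary tree: a rooted tree where each internal (non-leaf) node has a left child and a right child (the single-node tree is allowed). An increasing binary tree of size $n$ is a binary tree with $n$ internal nodes labeled with the distinct labels $1,2,\dots,n$ in such a way that labels increase when moving away from the root (leaves are unlabeled). Its $n$ internal nodes are indexed $0,1,\dots,n-1$ following an inorder traversal (recursively: the internal nodes of the left subtree in inorder, then the root, then the internal nodes of the right subtree in inorder); this indexing is unrelated to the labels. The depth of a node is the number of edges in the path from the root to it. The powers and the integral are understood as formal power series in $z$ (resp. $t$) with coefficients polynomial in $x,y$. *)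

theory Defs
  imports "HOL-Library.Tree" "HOL-Computational_Algebra.Computational_Algebra"
begin

section \<open>Increasing binary trees\<close>

text \<open>
  In a value of type \<^typ>\<open>'a tree\<close> the constructor \<^const>\<open>Node\<close> gives the internal nodes,
  \<^const>\<open>Leaf\<close> the (unlabeled) leaves, and \<^const>\<open>size\<close> counts the internal nodes. The condition
  \<^const>\<open>heap\<close> only asks for weakly increasing labels; as the labels are distinct,
  they increase strictly.
\<close>

definition increasing_trees :: "nat \<Rightarrow> nat tree set" where
  "increasing_trees n =
     {t. size t = n \<and> distinct (inorder t) \<and> set_tree t = {1..n} \<and> heap t}"

text \<open>The depths of the internal nodes, listed in the same order as \<^const>\<open>inorder\<close>.\<close>

fun inorder_depths :: "'a tree \<Rightarrow> nat list" where
  "inorder_depths Leaf = []"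
| "inorder_depths (Node l a r) =
     map Suc (inorder_depths l) @ [0] @ map Suc (inorder_depths r)"

lemma length_inorder_depths [simp]: "length (inorder_depths t) = size t"
  by (induction t) auto

lemma inorder_depths_less: "d \<in> set (inorder_depths t) \<Longrightarrow> d < size t"
proof (induction t arbitrary: d)
  case (Node l a r)
  then show ?case by (auto dest!: Node.IH)
qed simp

definition num_trees_depth :: "nat \<Rightarrow> nat \<Rightarrow> nat \<Rightarrow> nat" where
  "num_trees_depth n r d = card {t \<in> increasing_trees n. inorder_depths t ! r = d}"

lemma finite_increasing_trees: "finite (increasing_trees n)"
proof -
  have "finite {t. size t = k \<and> set_tree t \<subseteq> A}" if "finite A" for k and A :: "nat set"
  proof (induction k rule: less_induct)
    case (less k)
    define S where "S = (\<Union>j<k. {t. size t = j \<and> set_tree t \<subseteq> A})"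
    have "finite S" using less unfolding S_def by blast
    moreover have "{t. size t = k \<and> set_tree t \<subseteq> A} \<subseteq>
        insert Leaf ((\<lambda>(l, a, r). Node l a r) ` (S \<times> A \<times> S))"
    proof
      fix t assume "t \<in> {t. size t = k \<and> set_tree t \<subseteq> A}"
      then show "t \<in> insert Leaf ((\<lambda>(l, a, r). Node l a r) ` (S \<times> A \<times> S))"
        by (cases t) (auto simp: S_def image_iff)
    qed
    ultimately show ?case using \<open>finite A\<close> by (meson finite_SigmaI finite_imageI finite_insert finite_subset)
  qed
  from this[of "{1..n}" n] show ?thesis
    by (rule finite_subset[rotated]) (auto simp: increasing_trees_def)
qed

lemma num_trees_depth_eq_0:
  assumes "r < n" "n \<le> d"
  shows "num_trees_depth n r d = 0"
proof -
  have "inorder_depths t ! r < n" if "t \<in> increasing_trees n" for t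
    using that assms inorder_depths_less[of "inorder_depths t ! r" t]
    by (auto simp: increasing_trees_def)
  then have "{t \<in> increasing_trees n. inorder_depths t ! r = d} = {}"
    using assms by fastforce
  then show ?thesis by (simp only: num_trees_depth_def card.empty)
qed

section \<open>The generating function\<close>

text \<open>
  A polynomial in \<open>x\<close> and \<open>y\<close> is a polynomial in \<open>x\<close> whose coefficients are polynomials in \<open>y\<close>.
  Since a tree of size \<open>n\<close> has no node of depth \<open>n\<close> or more, bounding \<open>d\<close> by \<open>n\<close> loses no terms.
\<close>

definition J_gf :: "rat poly poly fps" where
  "J_gf = Abs_fps (\<lambda>n. \<Sum>r<n. \<Sum>d<n.
            monom (monom (of_nat (num_trees_depth n r d) / fact n) d) r)"

lemma coeff_J_gf:
  "coeff (coeff (J_gf $ n) r) d = (if r < n then of_nat (num_trees_depth n r d) / fact n else 0)"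
proof -
  have "coeff (coeff (J_gf $ n) r) d =
      (\<Sum>r'<n. \<Sum>d'<n. if r' = r then (if d' = d then of_nat (num_trees_depth n r' d') / fact n else 0) else 0)"
    by (simp add: J_gf_def coeff_sum if_distrib[of "\<lambda>p. coeff p d"] cong: if_cong)
  also have "\<dots> = (\<Sum>r'<n. if r' = r then (\<Sum>d'<n. if d' = d then of_nat (num_trees_depth n r' d') / fact n else 0) else 0)"
    by (intro sum.cong) auto
  also have "\<dots> = (if r < n then of_nat (num_trees_depth n r d) / fact n else 0)"
    by (auto simp: num_trees_depth_eq_0)
  finally show ?thesis .
qed

text \<open>
  The library operations on power series that involve division are available over fields of
  characteristic 0, so identities are stated after embedding the coefficients into
  the field of fractions \<open>\<rat>(x, y)\<close>. The embedding is injective.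
\<close>

type_synonym ratfun = "rat poly poly fract"

definition x_var :: ratfun where "x_var = to_fract (monom 1 1)"

definition y_var :: ratfun where "y_var = to_fract (monom (monom 1 1) 0)"

definition fps_to_fract :: "'a::idom fps \<Rightarrow> 'a fract fps" where
  "fps_to_fract f = Abs_fps (\<lambda>n. to_fract (f $ n))"

text \<open>
  For \<open>f\<close> with constant term 1, the formal power
  \<open>f\<^sup>a = (\<Sum>k. (a gchoose k) * (f - 1)\<^sup>k)\<close> with an arbitrary ring element \<open>a\<close> as exponent.
\<close>

definition fps_pow :: "'a::field_char_0 fps \<Rightarrow> 'a \<Rightarrow> 'a fps" where
  "fps_pow f a = fps_binomial a oo (f - 1)"

end

theory Submission
  imports Defs
begin

text \<open>
  The label 1 sits at the root of an increasing tree, and the rest of the tree is an arbitrary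
  way of distributing the other labels over a left and a right subtree, each of which is again an
  increasing tree on its set of labels (lemma \<open>sum_heaps_on\<close>). Give a tree the weight
  \<open>\<Sum>r. x\<^sup>r * y\<^sup>d\<close> where \<open>d\<close> is the depth of node \<open>r\<close>. Passing from a subtree to the whole tree
  multiplies this weight by \<open>y\<close>, and on the right also by \<open>x\<close> to the number of nodes preceding the
  right subtree; the root contributes \<open>x\<close> to the size of the left subtree. As there are \<open>n!\<close>
  increasing trees of size \<open>n\<close>, the coefficients \<open>j n\<close> of \<open>z\<^sup>n\<close> in \<open>J\<close> satisfy

  \<open>(n + 1) * j (n + 1) = (\<Sum>k\<le>n. y * j k + x\<^sup>k + y * x\<^sup>k\<^sup>+\<^sup>1 * j (n - k))\<close>

  (lemma \<open>J_coeff_Suc\<close>), where \<open>k\<close> is the size of the left subtree. For the series this says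
  \<open>J' = y * J / (1 - z) + 1 / ((1 - z) * (1 - x * z)) + x * y * J / (1 - x * z)\<close>, and with
  \<open>P = (1 - z) * (1 - x * z)\<close> it is the linear equation \<open>P * J' = 1 - y * P' * J\<close>
  (lemma \<open>J_coeff_ODE\<close>). Its integrating factor is \<open>P\<^sup>y\<close>: the derivative of \<open>P\<^sup>y * J\<close> is
  \<open>P\<^sup>y\<^sup>-\<^sup>1\<close>. Integrating from 0, where \<open>J\<close> vanishes, gives the formula
  (lemma \<open>linear_ODE_solution\<close>).
\<close>

section \<open>Decomposing increasing trees at the root\<close>

text \<open>
  The subtrees of an increasing tree carry arbitrary sets of labels, so the recursion needs
  label sets other than \<open>{1..n}\<close>.
\<close>

definition heaps_on :: "nat set \<Rightarrow> nat tree set" where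
  "heaps_on A = {t. set_tree t = A \<and> distinct (inorder t) \<and> heap t}"

lemma size_heaps_on: "t \<in> heaps_on A \<Longrightarrow> size t = card A"
  by (metis (mono_tags) distinct_card heaps_on_def length_inorder mem_Collect_eq set_inorder)

lemma increasing_trees_eq: "increasing_trees n = heaps_on {1..n}"
  using size_heaps_on[of _ "{1..n}"] by (auto simp: increasing_trees_def heaps_on_def)

lemma heaps_on_empty [simp]: "heaps_on {} = {Leaf}"
  by (auto simp: heaps_on_def)

text \<open>
  The root of a heap with distinct labels carries the least label, and the remaining labels
  are split freely between its two subtrees.
\<close>

lemma heaps_on_eq_image:
  assumes "finite A" "A \<noteq> {}"
  defines "B \<equiv> A - {Min A}"
  shows "heaps_on A = (\<lambda>(S, l, r). Node l (Min A) r) ` (SIGMA S:Pow B. heaps_on S \<times> heaps_on (B - S))"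
    (is "_ = ?f ` ?D")
proof (intro equalityI subsetI)
  fix t assume t: "t \<in> heaps_on A"
  with assms obtain l a r where [simp]: "t = Node l a r"
    by (cases t) (auto simp: heaps_on_def)
  have A: "A = insert a (set_tree l \<union> set_tree r)"
    using t by (auto simp: heaps_on_def)
  have "a = Min A"
    using t assms(1) by (intro Min_eqI[symmetric]) (auto simp: heaps_on_def)
  moreover have "a \<notin> set_tree l" "a \<notin> set_tree r" "set_tree l \<inter> set_tree r = {}"
    using t by (auto simp: heaps_on_def)
  moreover from calculation A have "set_tree l \<subseteq> B" "set_tree r = B - set_tree l"
    unfolding B_def by auto
  ultimately have "(set_tree l, l, r) \<in> ?D" "t = ?f (set_tree l, l, r)"
    using t by (auto simp: heaps_on_def)
  then show "t \<in> ?f ` ?D" by blast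
next
  fix t assume "t \<in> ?f ` ?D"
  then obtain S l r where S: "S \<subseteq> B" "l \<in> heaps_on S" "r \<in> heaps_on (B - S)"
    and [simp]: "t = Node l (Min A) r" by auto
  have "Min A \<in> A" using assms(1,2) by (rule Min_in)
  then have "A = insert (Min A) B" "Min A \<notin> B" "\<forall>b\<in>B. Min A \<le> b"
    using assms(1) by (auto simp: B_def)
  with S show "t \<in> heaps_on A"
    by (auto simp: heaps_on_def)
qed

lemma finite_heaps_on: "finite A \<Longrightarrow> finite (heaps_on A)"
proof (induction A rule: finite_psubset_induct)
  case (psubset A)
  show ?case
  proof (cases "A = {}")
    case False
    have "Min A \<in> A" using psubset.hyps False by (rule Min_in)
    then have "finite (heaps_on S)" "finite (heaps_on (A - {Min A} - S))"
      if "S \<in> Pow (A - {Min A})" for S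
      using that by (auto intro!: psubset.IH)
    then show ?thesis
      unfolding heaps_on_eq_image[OF psubset.hyps False]
      using psubset.hyps by (intro finite_imageI finite_SigmaI) simp_all
  qed simp
qed

lemma sum_heaps_on:
  fixes f :: "nat tree \<Rightarrow> 'a::comm_monoid_add"
  assumes "finite A" "A \<noteq> {}"
  defines "B \<equiv> A - {Min A}"
  shows "sum f (heaps_on A) = (\<Sum>S\<in>Pow B. \<Sum>l\<in>heaps_on S. \<Sum>r\<in>heaps_on (B - S). f (Node l (Min A) r))"
proof -
  have fin: "finite (heaps_on S)" "finite (heaps_on (B - S))" if "S \<in> Pow B" for S
    using that assms(1) by (auto simp: B_def intro!: finite_heaps_on intro: finite_subset)
  have "inj_on (\<lambda>(S, l, r). Node l (Min A) r) (SIGMA S:Pow B. heaps_on S \<times> heaps_on (B - S))"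
    by (auto simp: inj_on_def heaps_on_def)
  then have "sum f (heaps_on A) =
      (\<Sum>(S, l, r)\<in>(SIGMA S:Pow B. heaps_on S \<times> heaps_on (B - S)). f (Node l (Min A) r))"
    using assms(1,2)
    by (subst heaps_on_eq_image) (auto simp: sum.reindex B_def o_def case_prod_unfold)
  also have "\<dots> = (\<Sum>S\<in>Pow B. \<Sum>(l, r)\<in>heaps_on S \<times> heaps_on (B - S). f (Node l (Min A) r))"
    using assms(1) fin by (subst sum.Sigma) (auto simp: B_def)
  also have "\<dots> = (\<Sum>S\<in>Pow B. \<Sum>l\<in>heaps_on S. \<Sum>r\<in>heaps_on (B - S). f (Node l (Min A) r))"
    by (simp add: sum.cartesian_product)
  finally show ?thesis .
qed

lemma sum_Pow_card:
  fixes h :: "nat \<Rightarrow> 'a::comm_semiring_1"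
  assumes "finite B"
  shows "(\<Sum>S\<in>Pow B. h (card S)) = (\<Sum>k\<le>card B. of_nat (card B choose k) * h k)"
proof -
  have "(\<Sum>S\<in>Pow B. h (card S)) = (\<Sum>k\<le>card B. \<Sum>S | S \<in> Pow B \<and> card S = k. h (card S))"
    using assms by (intro sum.group[symmetric]) (auto intro: card_mono)
  also have "\<dots> = (\<Sum>k\<le>card B. of_nat (card B choose k) * h k)"
    using assms by (intro sum.cong) (auto simp: n_subsets)
  finally show ?thesis .
qed

text \<open>
  With \<open>n + 1\<close> labels, each size \<open>k\<close> of the left subtree accounts for
  \<open>(n choose k) * k! * (n - k)! = n!\<close> trees, and there are \<open>n + 1\<close> possible sizes.
\<close>

lemma card_heaps_on: "finite A \<Longrightarrow> card (heaps_on A) = fact (card A)"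
proof (induction A rule: finite_psubset_induct)
  case (psubset A)
  show ?case
  proof (cases "A = {}")
    case False
    define B where "B = A - {Min A}"
    have "Min A \<in> A" using psubset.hyps False by (rule Min_in)
    then have "finite B" and B: "B \<subset> A" and cA: "card A = Suc (card B)"
      using psubset.hyps card.remove[of A "Min A"] unfolding B_def by auto
    have "card (heaps_on A) = (\<Sum>S\<in>Pow B. card (heaps_on S) * card (heaps_on (B - S)))"
      unfolding card_eq_sum using sum_heaps_on[of A "\<lambda>_. 1::nat"] psubset.hyps False
      by (simp add: B_def)
    also have "\<dots> = (\<Sum>S\<in>Pow B. fact (card S) * fact (card B - card S))"
    proof (intro sum.cong refl)
      fix S assume "S \<in> Pow B"
      then have "S \<subset> A" "B - S \<subset> A" "card (B - S) = card B - card S"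
        using B \<open>finite B\<close> by (auto intro!: card_Diff_subset intro: finite_subset)
      then show "card (heaps_on S) * card (heaps_on (B - S)) = fact (card S) * fact (card B - card S)"
        using psubset.IH by simp
    qed
    also have "\<dots> = (\<Sum>k\<le>card B. (card B choose k) * (fact k * fact (card B - k)))"
      using sum_Pow_card[OF \<open>finite B\<close>, of "\<lambda>k. fact k * fact (card B - k) :: nat"] by simp
    also have "\<dots> = (\<Sum>k\<le>card B. fact (card B))"
    proof (intro sum.cong refl)
      fix k assume "k \<in> {..card B}"
      then have "fact k * fact (card B - k) * (card B choose k) = fact (card B)"
        by (intro binomial_fact_lemma) simp
      then show "(card B choose k) * (fact k * fact (card B - k)) = fact (card B)"
        by (simp only: mult.commute)
    qed
    finally show ?thesis by (simp add: cA)
  qed simp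
qed

section \<open>The recurrence for the depth polynomials\<close>

definition depth_poly :: "'a::comm_semiring_1 \<Rightarrow> 'a \<Rightarrow> 'b tree \<Rightarrow> 'a" where
  "depth_poly x y t = (\<Sum>r<size t. x ^ r * y ^ (inorder_depths t ! r))"

lemma depth_poly_Leaf [simp]: "depth_poly x y Leaf = 0"
  by (simp add: depth_poly_def)

text \<open>
  In inorder the left subtree keeps its indices, the root gets index \<open>size l\<close>, and the indices of
  the right subtree are shifted by \<open>Suc (size l)\<close>. All depths in the subtrees grow by one.
\<close>

lemma depth_poly_Node:
  "depth_poly x y (Node l a r) =
    y * depth_poly x y l + x ^ size l + y * x ^ Suc (size l) * depth_poly x y r"
proof -
  let ?g = "\<lambda>i. x ^ i * y ^ (inorder_depths (Node l a r) ! i)"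
  have split: "sum g {..<m + Suc n} = sum g {..<m} + g m + (\<Sum>i<n. g (Suc m + i))"
    for g :: "nat \<Rightarrow> 'a" and m n
    by (induction n) (auto simp: add_ac)
  have "depth_poly x y (Node l a r) = sum ?g {..<size l + Suc (size r)}"
    by (simp add: depth_poly_def)
  also have "\<dots> = (\<Sum>i<size l. ?g i) + ?g (size l) + (\<Sum>i<size r. ?g (Suc (size l) + i))"
    by (rule split)
  also have "(\<Sum>i<size l. ?g i) = y * depth_poly x y l"
    by (simp add: depth_poly_def sum_distrib_left nth_append mult_ac)
  also have "?g (size l) = x ^ size l"
    by (simp add: nth_append)
  also have "(\<Sum>i<size r. ?g (Suc (size l) + i)) = y * x ^ Suc (size l) * depth_poly x y r"
    by (simp add: depth_poly_def sum_distrib_left nth_append power_add mult_ac)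
  finally show ?thesis .
qed

definition total_depth_poly :: "'a::comm_semiring_1 \<Rightarrow> 'a \<Rightarrow> nat set \<Rightarrow> 'a" where
  "total_depth_poly x y A = (\<Sum>t\<in>heaps_on A. depth_poly x y t)"

text \<open>
  The values on smaller label sets are given by an arbitrary sequence \<open>g\<close>, because this step serves
  twice: to show by induction that the total depends only on the number of labels, and then
  to obtain the recurrence itself. The binomial coefficient that counts the label sets of the left
  subtree cancels against the factorials, which is why the exponential normalisation is natural.
\<close>

lemma total_depth_poly_step:
  fixes x y :: "'a::field_char_0"
  assumes "finite A" "card A = Suc n"
  assumes g: "\<And>S. S \<subset> A \<Longrightarrow> total_depth_poly x y S = fact (card S) * g (card S)"
  shows "total_depth_poly x y A =
    fact n * (\<Sum>k\<le>n. y * g k + x ^ k + y * x ^ Suc k * g (n - k))"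
proof -
  define B where "B = A - {Min A}"
  have "A \<noteq> {}" using assms by auto
  have "Min A \<in> A" using assms(1) \<open>A \<noteq> {}\<close> by (rule Min_in)
  then have "finite B" and B: "B \<subset> A" and cB: "card B = n"
    using assms(1,2) by (auto simp: B_def)
  let ?h = "\<lambda>k. y * g k + x ^ k + y * x ^ Suc k * g (n - k)"
  have "total_depth_poly x y A =
      (\<Sum>S\<in>Pow B. \<Sum>l\<in>heaps_on S. \<Sum>r\<in>heaps_on (B - S). depth_poly x y (Node l (Min A) r))"
    unfolding total_depth_poly_def B_def by (rule sum_heaps_on) fact+
  also have "\<dots> = (\<Sum>S\<in>Pow B. fact (card S) * fact (n - card S) * ?h (card S))"
  proof (intro sum.cong refl)
    fix S assume "S \<in> Pow B"
    then have S: "S \<subset> A" "B - S \<subset> A" "card (B - S) = n - card S" "finite S" "finite (B - S)"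
      using B cB \<open>finite B\<close> by (auto intro!: card_Diff_subset intro: finite_subset)
    have "(\<Sum>l\<in>heaps_on S. \<Sum>r\<in>heaps_on (B - S). depth_poly x y (Node l (Min A) r)) =
       (\<Sum>l\<in>heaps_on S. \<Sum>r\<in>heaps_on (B - S).
          y * depth_poly x y l + x ^ card S + y * x ^ Suc (card S) * depth_poly x y r)"
      by (intro sum.cong refl) (simp only: depth_poly_Node size_heaps_on)
    also have "\<dots> = fact (n - card S) * y * total_depth_poly x y S
        + fact (card S) * fact (n - card S) * x ^ card S
        + fact (card S) * y * x ^ Suc (card S) * total_depth_poly x y (B - S)"
      using S by (simp add: sum.distrib card_heaps_on total_depth_poly_def
          sum_distrib_left[symmetric] sum_distrib_right[symmetric] algebra_simps)
    also have "\<dots> = fact (card S) * fact (n - card S) * ?h (card S)"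
      using g[OF S(1)] g[OF S(2)] S(3) by (simp add: algebra_simps)
    finally show "(\<Sum>l\<in>heaps_on S. \<Sum>r\<in>heaps_on (B - S). depth_poly x y (Node l (Min A) r)) =
      fact (card S) * fact (n - card S) * ?h (card S)" .
  qed
  also have "\<dots> = (\<Sum>k\<le>n. of_nat (n choose k) * (fact k * fact (n - k) * ?h k))"
    using sum_Pow_card[OF \<open>finite B\<close>, of "\<lambda>k. fact k * fact (n - k) * ?h k"] by (simp only: cB)
  also have "\<dots> = (\<Sum>k\<le>n. fact n * ?h k)"
    by (intro sum.cong refl) (simp add: binomial_fact)
  finally show ?thesis by (simp add: sum_distrib_left)
qed

text \<open>
  Instead of relabelling trees along an order isomorphism, the root decomposition is applied to both
  label sets: it produces the same expression for each.
\<close>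

lemma total_depth_poly_cong_card:
  fixes x y :: "'a::field_char_0"
  assumes "finite A"
  shows "total_depth_poly x y A = total_depth_poly x y {1..card A}"
  using assms
proof (induction "card A" arbitrary: A rule: less_induct)
  case (less A)
  show ?case
  proof (cases "card A")
    case (Suc n)
    define g where "g k = total_depth_poly x y {1..k} / fact k" for k
    have "total_depth_poly x y S = fact (card S) * g (card S)"
      if "S \<subset> A'" "finite A'" "card A' = card A" for S A'
      using less(1)[of S] that psubset_card_mono[of A' S]
      by (auto simp: g_def intro: finite_subset)
    then have "total_depth_poly x y A' =
        fact n * (\<Sum>k\<le>n. y * g k + x ^ k + y * x ^ Suc k * g (n - k))"
      if "finite A'" "card A' = card A" for A'
      using that Suc by (intro total_depth_poly_step) auto
    from this[of A] this[of "{1..card A}"] less(2) show ?thesis by simp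
  qed (use less in auto)
qed

definition J_coeff :: "'a::field_char_0 \<Rightarrow> 'a \<Rightarrow> nat \<Rightarrow> 'a" where
  "J_coeff x y n = total_depth_poly x y {1..n} / fact n"

lemma J_coeff_0 [simp]: "J_coeff x y 0 = 0"
  by (simp add: J_coeff_def total_depth_poly_def)

lemma J_coeff_Suc:
  "of_nat (Suc n) * J_coeff x y (Suc n) =
    (\<Sum>k\<le>n. y * J_coeff x y k + x ^ k + y * x ^ Suc k * J_coeff x y (n - k))"
proof -
  have "total_depth_poly x y {1..Suc n} =
      fact n * (\<Sum>k\<le>n. y * J_coeff x y k + x ^ k + y * x ^ Suc k * J_coeff x y (n - k))"
  proof (intro total_depth_poly_step)
    fix S assume "S \<subset> {1..Suc n}"
    then have "finite S" by (metis finite_atLeastAtMost finite_subset psubset_imp_subset)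
    then show "total_depth_poly x y S = fact (card S) * J_coeff x y (card S)"
      by (simp add: J_coeff_def total_depth_poly_cong_card[of S])
  qed simp_all
  then show ?thesis
    by (simp add: J_coeff_def divide_simps del: of_nat_Suc)
qed

text \<open>
  The three parts of the recurrence are Cauchy products involving the geometric series
  \<open>U = 1 / (1 - z)\<close> and \<open>V = 1 / (1 - x * z)\<close>, so that \<open>F' = y * F * U + V * U + x * y * V * F\<close>.
  Multiplication by \<open>P\<close> clears both denominators, and
  \<open>P' = - (1 - x * z) - x * (1 - z)\<close> collects the two terms containing \<open>F\<close>.
\<close>

lemma J_coeff_ODE:
  fixes x y :: "'a::field_char_0"
  defines "F \<equiv> Abs_fps (J_coeff x y)" and "P \<equiv> (1 - fps_X) * (1 - fps_const x * fps_X)"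
  shows "P * fps_deriv F = 1 - fps_const y * fps_deriv P * F"
proof -
  define U where "U = (Abs_fps (\<lambda>_. 1) :: 'a fps)"
  define V where "V = Abs_fps (\<lambda>n. x ^ n)"
  have U: "(1 - fps_X) * U = 1"
    by (rule fps_ext) (simp add: U_def left_diff_distrib fps_X_mult_nth)
  have V: "(1 - fps_const x * fps_X) * V = 1"
  proof (rule fps_ext)
    show "((1 - fps_const x * fps_X) * V) $ n = 1 $ n" for n
      by (cases n) (simp_all add: V_def left_diff_distrib mult.assoc)
  qed
  have "fps_deriv F = fps_const y * F * U + V * U + fps_const (x * y) * V * F"
  proof (rule fps_ext)
    fix n
    have "(fps_const y * F * U) $ n = (\<Sum>k\<le>n. y * J_coeff x y k)"
      by (simp only: mult.assoc fps_mult_left_const_nth)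
         (simp add: F_def U_def fps_mult_nth atLeast0AtMost sum_distrib_left)
    moreover have "(V * U) $ n = (\<Sum>k\<le>n. x ^ k)"
      by (simp add: V_def U_def fps_mult_nth atLeast0AtMost)
    moreover have "(fps_const (x * y) * V * F) $ n = (\<Sum>k\<le>n. y * x ^ Suc k * J_coeff x y (n - k))"
      by (simp only: mult.assoc fps_mult_left_const_nth)
         (simp add: F_def V_def fps_mult_nth atLeast0AtMost sum_distrib_left mult_ac)
    moreover have "fps_deriv F $ n = of_nat (Suc n) * J_coeff x y (Suc n)"
      by (simp add: F_def)
    ultimately show "fps_deriv F $ n =
        (fps_const y * F * U + V * U + fps_const (x * y) * V * F) $ n"
      by (simp only: J_coeff_Suc fps_add_nth sum.distrib)
  qed
  then have "P * fps_deriv F =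
      fps_const y * (1 - fps_const x * fps_X) * F * ((1 - fps_X) * U)
      + ((1 - fps_const x * fps_X) * V) * ((1 - fps_X) * U)
      + fps_const (x * y) * (1 - fps_X) * F * ((1 - fps_const x * fps_X) * V)"
    unfolding P_def by (simp only:) (simp only: algebra_simps)
  also have "\<dots> = 1 - fps_const y * fps_deriv P * F"
    unfolding U V P_def by (simp add: algebra_simps flip: fps_const_mult)
  finally show ?thesis .
qed

section \<open>Formal powers and the solution of the differential equation\<close>

lemma fps_pow_add:
  assumes "f $ 0 = 1"
  shows "fps_pow f (a + b) = fps_pow f a * fps_pow f b"
  using assms by (simp add: fps_pow_def fps_binomial_add_mult fps_compose_mult_distrib)

lemma fps_pow_0 [simp]: "fps_pow f 0 = 1"
  by (simp add: fps_pow_def)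

lemma fps_pow_1:
  assumes "f $ 0 = 1"
  shows "fps_pow f 1 = f"
  using assms by (simp add: fps_pow_def fps_binomial_1 fps_compose_add_distrib)

text \<open>
  The power rule, in a form without division. It is the chain rule applied to the differential
  equation \<open>(1 + X) * b' = a * b\<close> of the binomial series \<open>b\<close>.
\<close>

lemma fps_deriv_pow:
  assumes "f $ 0 = 1"
  shows "f * fps_deriv (fps_pow f a) = fps_const a * fps_deriv f * fps_pow f a"
proof -
  have f0: "(f - 1) $ 0 = 0" using assms by simp
  have "(1 + fps_X) * fps_deriv (fps_binomial a) = fps_const a * fps_binomial a"
    by (simp add: fps_binomial_deriv fps_divide_unit mult_ac inverse_mult_eq_1')
  then have "((1 + fps_X) oo (f - 1)) * (fps_deriv (fps_binomial a) oo (f - 1)) =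
      (fps_const a * fps_binomial a) oo (f - 1)"
    by (metis fps_compose_mult_distrib[OF f0])
  then have "f * (fps_deriv (fps_binomial a) oo (f - 1)) = fps_const a * fps_pow f a"
    using f0 by (simp add: fps_compose_add_distrib fps_compose_mult_distrib fps_pow_def)
  then show ?thesis
    using f0 by (simp add: fps_pow_def fps_compose_deriv mult_ac)
qed

text \<open>
  The integrating factor: by the power rule and the equation for \<open>F\<close>, the two terms
  \<open>y * P' * P\<^sup>y * F\<close> in \<open>P * (P\<^sup>y * F)'\<close> cancel and leave \<open>P\<^sup>y = P * P\<^sup>y\<^sup>-\<^sup>1\<close>.
\<close>

lemma linear_ODE_solution:
  fixes P F :: "'a::field_char_0 fps"
  assumes P0: "P $ 0 = 1" and F0: "F $ 0 = 0"
    and ODE: "P * fps_deriv F = 1 - fps_const y * fps_deriv P * F"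
  shows "F = fps_pow P (- y) * fps_integral0 (fps_pow P (y - 1))"
proof -
  define Q where "Q = fps_pow P y * F"
  have "P * fps_deriv Q = (P * fps_deriv (fps_pow P y)) * F + fps_pow P y * (P * fps_deriv F)"
    by (simp add: Q_def algebra_simps)
  also have "\<dots> = fps_pow P y"
    unfolding ODE fps_deriv_pow[OF P0] by (simp add: algebra_simps)
  also have "\<dots> = P * fps_pow P (y - 1)"
    using fps_pow_add[OF P0, of 1 "y - 1"] by (simp add: fps_pow_1[OF P0])
  finally have "fps_deriv Q = fps_pow P (y - 1)"
    using P0 by (metis fps_nonzero_nth mult_left_cancel zero_neq_one)
  then have "fps_integral0 (fps_pow P (y - 1)) = Q"
    using fps_integral0_deriv[of Q] F0 by (simp add: Q_def)
  moreover have "fps_pow P (- y) * Q = F"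
    using fps_pow_add[OF P0, of "- y" y] by (simp add: Q_def flip: mult.assoc)
  ultimately show ?thesis by simp
qed

section \<open>The generating function\<close>

lemma to_fract_of_nat: "to_fract (of_nat n) = of_nat n"
  by (induction n) auto

lemma to_fract_power: "to_fract (a ^ n) = to_fract a ^ n"
  by (induction n) auto

text \<open>
  The coefficients of the generating function contain \<open>1 / n!\<close> as a rational number inside a
  monomial. Multiplying by \<open>n!\<close> in the polynomial ring leaves only numbers of trees, which the
  embedding into the field of fractions preserves.
\<close>

lemma fact_mult_monom_monom:
  "fact n * monom (monom (of_nat m / fact n) d) r =
    of_nat m * (monom 1 1 ^ r * monom (monom 1 1) 0 ^ d :: rat poly poly)"
proof -
  have m: "(of_nat k :: rat poly poly) = monom (monom (of_nat k) 0) 0" for k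
    by (simp only: of_nat_poly monom_0)
  have f: "(fact n :: rat poly poly) = monom (monom (fact n) 0) 0"
    using m[of "fact n"] by (simp only: of_nat_fact)
  show ?thesis
    unfolding f m by (simp add: mult_monom monom_power)
qed

text \<open>Double counting of the pairs of a tree and a node, grouped by the depth of the node.\<close>

lemma sum_num_trees_depth:
  fixes x y :: "'a::comm_semiring_1"
  shows "(\<Sum>r<n. \<Sum>d<n. of_nat (num_trees_depth n r d) * (x ^ r * y ^ d)) =
    total_depth_poly x y {1..n}"
proof -
  have "(\<Sum>d<n. of_nat (num_trees_depth n r d) * (x ^ r * y ^ d)) =
      (\<Sum>t\<in>increasing_trees n. x ^ r * y ^ (inorder_depths t ! r))" if "r < n" for r
  proof -
    have "(\<lambda>t. inorder_depths t ! r) ` increasing_trees n \<subseteq> {..<n}"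
      using that by (auto simp: increasing_trees_def intro!: inorder_depths_less)
    then have "(\<Sum>t\<in>increasing_trees n. x ^ r * y ^ (inorder_depths t ! r)) =
       (\<Sum>d<n. \<Sum>t | t \<in> increasing_trees n \<and> inorder_depths t ! r = d.
          x ^ r * y ^ (inorder_depths t ! r))"
      by (intro sum.group[symmetric] finite_increasing_trees) auto
    also have "\<dots> = (\<Sum>d<n. of_nat (num_trees_depth n r d) * (x ^ r * y ^ d))"
      by (simp add: num_trees_depth_def)
    finally show ?thesis by simp
  qed
  then have "(\<Sum>r<n. \<Sum>d<n. of_nat (num_trees_depth n r d) * (x ^ r * y ^ d)) =
      (\<Sum>r<n. \<Sum>t\<in>increasing_trees n. x ^ r * y ^ (inorder_depths t ! r))"
    by simp
  also have "\<dots> = (\<Sum>t\<in>increasing_trees n. \<Sum>r<n. x ^ r * y ^ (inorder_depths t ! r))"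
    by (rule sum.swap)
  also have "\<dots> = (\<Sum>t\<in>increasing_trees n. depth_poly x y t)"
    by (intro sum.cong) (auto simp: depth_poly_def increasing_trees_def)
  finally show ?thesis by (simp add: total_depth_poly_def increasing_trees_eq)
qed

lemma fps_to_fract_J_gf: "fps_to_fract J_gf = Abs_fps (J_coeff x_var y_var)"
proof (rule fps_ext)
  fix n
  have *: "fact n * J_gf $ n = (\<Sum>r<n. \<Sum>d<n. of_nat (num_trees_depth n r d) *
      (monom 1 1 ^ r * monom (monom 1 1) 0 ^ d))"
    by (simp add: J_gf_def sum_distrib_left fact_mult_monom_monom)
  have "to_fract (fact n * J_gf $ n) = total_depth_poly x_var y_var {1..n}"
    unfolding * by (simp only: to_fract_sum to_fract_mult to_fract_power to_fract_of_nat
        flip: x_var_def y_var_def sum_num_trees_depth)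
  moreover have "to_fract (fact n) = (fact n :: ratfun)"
    by (metis of_nat_fact to_fract_of_nat)
  ultimately show "fps_to_fract J_gf $ n = Abs_fps (J_coeff x_var y_var) $ n"
    by (simp add: fps_to_fract_def J_coeff_def field_simps)
qed

theorem theorem7p3:
  shows "fps_to_fract J_gf =
    fps_pow ((1 - fps_X) * (1 - fps_const x_var * fps_X)) (- y_var) *
    fps_integral0 (fps_pow ((1 - fps_X) * (1 - fps_const x_var * fps_X)) (y_var - 1))"
  unfolding fps_to_fract_J_gf
  by (rule linear_ODE_solution[OF _ _ J_coeff_ODE]) simp_all

end
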